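(* Let $n\ge2$, let $A,B$ be real symmetric positive definite $n\times n$ matrices, and let $\alpha\in\mathbb{R}^n$ with $|\alpha|=1$. Set $P=I_n-\alpha\alpha^T$. Then $$\frac{\operatorname{Tr}(P(A+B)^{-1})}{\sigma_2((A+B)^{-1})}\ \ge\ \frac{\operatorname{Tr}(PA^{-1})}{\sigma_2(A^{-1})}+\frac{\operatorname{Tr}(PB^{-1})}{\sigma_2(B^{-1})}.$$
   Context: For a real symmetric $n\times n$ matrix $M$ with eigenvalues $\mu_1,\dots,\mu_n$, $\sigma_2(M)=\sum_{1\le i<j\le n}\mu_i\mu_j$. *)

theory Defs
  imports
    "HOL-Analysis.Analysis"
    "HOL-Computational_Algebra.Polynomial"
begin

definition charpoly :: "real^'n^'n \<Rightarrow> real poly" where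
  "charpoly M = det (mat [:0, 1:] - (\<chi> i j. [:M $ i $ j:]))"

(* The real eigenvalues, each repeated according to its algebraic multiplicity. For a symmetric
   matrix all roots of the characteristic polynomial are real, so nothing is lost and the
   multiset has CARD('n) elements. *)
definition eigenvalues :: "real^'n^'n \<Rightarrow> real multiset" where
  "eigenvalues M = proots (charpoly M)"

(* Only meaningful for symmetric M. The sum does not depend on the order in which the eigenvalues
   are listed. *)
definition sigma2 :: "real^'n^'n \<Rightarrow> real" where
  "sigma2 M = (let \<mu> = sorted_list_of_multiset (eigenvalues M)
               in \<Sum>j<length \<mu>. \<Sum>i<j. \<mu> ! i * \<mu> ! j)"

definition sym_pos_def :: "real^'n^'n \<Rightarrow> bool" where
  "sym_pos_def M \<longleftrightarrow> transpose M = M \<and> (\<forall>x. x \<noteq> 0 \<longrightarrow> x \<bullet> (M *v x) > 0)"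

end

(* Put M = A^-1 and \<tau> = Tr(PM). Computing with traces,
     2 \<sigma>_2(M) / \<tau> = \<Sum>_x (x . Mx - |PMx|^2 / \<tau>),
   where x runs over the standard axes and \<alpha>. Each summand is the minimum over d of
     x . Mx - 2 x . MPd + \<tau> |d|^2,
   and this is the M-norm squared of a tuple of vectors that is affine in d, so the convexity of
   (A, p) \<mapsto> p . A^-1 p makes s(A) = 2 \<sigma>_2(M) / \<tau> satisfy s(A + B) \<le> t^2 s(A) + (1 - t)^2 s(B) for
   all t. The optimal t gives 1 / s(A + B) \<ge> 1 / s(A) + 1 / s(B). *)
theory Submission
  imports Defs
begin

subsection \<open>The second symmetric function of the spectrum as a trace\<close>

text \<open>Newton's identity p_1^2 = p_2 + 2 e_2, in the indexed form that \<open>sigma2\<close>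
  uses.\<close>

lemma sum_pairs_list:
  fixes xs :: "real list"
  shows "2 * (\<Sum>j<length xs. \<Sum>i<j. xs ! i * xs ! j) = (sum_list xs)\<^sup>2 - (\<Sum>x\<leftarrow>xs. x\<^sup>2)"
proof (induction xs rule: rev_induct)
  case Nil
  then show ?case by simp
next
  case (snoc a xs)
  have "(\<Sum>j<length xs. \<Sum>i<j. (xs @ [a]) ! i * (xs @ [a]) ! j) = (\<Sum>j<length xs. \<Sum>i<j. xs ! i * xs ! j)"
    by (intro sum.cong) (auto simp: nth_append)
  moreover have "(\<Sum>i<length xs. (xs @ [a]) ! i * a) = sum_list xs * a"
    by (simp add: sum_list_sum_nth atLeast0LessThan sum_distrib_right nth_append)
  ultimately show ?case
    using snoc.IH by (simp add: power2_eq_square algebra_simps)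
qed

section \<open>The spectral theorem for real symmetric matrices\<close>

text \<open>A maximizer of the Rayleigh quotient is an eigenvector.\<close>
lemma exists_eigenvector:
  fixes f :: "'a::euclidean_space \<Rightarrow> 'a"
  assumes f: "linear f" and self: "\<And>x y. x \<bullet> f y = f x \<bullet> y"
    and S: "subspace S" "f ` S \<subseteq> S" "S \<noteq> {0}"
  obtains v c where "v \<in> S" "norm v = 1" "f v = c *\<^sub>R v"
proof -
  let ?K = "S \<inter> sphere 0 1"
  obtain s where s: "s \<in> S" "s \<noteq> 0"
    using S subspace_0 by blast
  have "s /\<^sub>R norm s \<in> ?K"
    using s S(1) by (auto simp: subspace_scale)
  then have "?K \<noteq> {}" by blast
  moreover have "compact ?K"
    using closed_subspace[OF S(1)] by (intro closed_Int_compact) auto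
  moreover have "continuous_on ?K (\<lambda>x. x \<bullet> f x)"
    by (intro continuous_intros linear_continuous_on) (use f linear_conv_bounded_linear in blast)
  ultimately obtain v where v: "v \<in> ?K" and max: "\<And>x. x \<in> ?K \<Longrightarrow> x \<bullet> f x \<le> v \<bullet> f v"
    using continuous_attains_sup[of ?K "\<lambda>x. x \<bullet> f x"] by blast
  define c where "c = v \<bullet> f v"
  have vv: "v \<bullet> v = 1" using v by (simp add: dot_square_norm)
  have le: "x \<bullet> f x \<le> c * (x \<bullet> x)" if "x \<in> S" for x
  proof (cases "x = 0")
    case False
    then have "(x /\<^sub>R norm x) \<bullet> f (x /\<^sub>R norm x) \<le> c"
      unfolding c_def using that S(1) by (intro max) (auto simp: subspace_scale)
    then show ?thesis
      using False by (simp add: linear_scale[OF f] dot_square_norm field_simps power2_eq_square)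
  qed simp
  \<comment> \<open>First-order optimality of \<open>v\<close> in the direction of the residual \<open>w\<close>.\<close>
  define w where "w = c *\<^sub>R v - f v"
  have wS: "w \<in> S"
    unfolding w_def using v S by (intro subspace_diff subspace_scale) auto
  have fv: "f v = c *\<^sub>R v - w" by (simp add: w_def)
  have vw: "v \<bullet> w = 0"
    unfolding w_def by (simp add: inner_diff_right vv c_def)
  define \<phi> where "\<phi> = c * (w \<bullet> w) - w \<bullet> f w"
  have \<phi>: "0 \<le> 2 * t * (w \<bullet> w) + t\<^sup>2 * \<phi>" for t
  proof -
    have "v + t *\<^sub>R w \<in> S" using v wS S(1) by (intro subspace_add subspace_scale) auto
    from le[OF this] show ?thesis
      using self[of v w] vw vv
      by (simp add: linear_add[OF f] linear_scale[OF f] inner_add_left inner_add_right fv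
          inner_diff_left inner_diff_right inner_commute[of w v] \<phi>_def power2_eq_square algebra_simps)
  qed
  have "w \<bullet> w = 0"
  proof (rule ccontr)
    assume "w \<bullet> w \<noteq> 0"
    then have pos: "w \<bullet> w > 0" by auto
    \<comment> \<open>The bound is tested at t = -(w . w) / \<open>?d\<close>. Since \<phi> \<le>
      \<open>?d\<close>, the quadratic term is at most half the size of the negative linear term,
      whatever the sign of \<phi>.\<close>
    let ?d = "\<bar>\<phi>\<bar> + 1"
    have "(w \<bullet> w)\<^sup>2 * \<phi> / ?d\<^sup>2 \<le> (w \<bullet> w)\<^sup>2 * ?d / ?d\<^sup>2"
      by (intro divide_right_mono mult_left_mono) auto
    also have "\<dots> = (w \<bullet> w)\<^sup>2 / ?d" by (simp add: power2_eq_square)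
    finally have "(w \<bullet> w)\<^sup>2 * \<phi> / ?d\<^sup>2 \<le> (w \<bullet> w)\<^sup>2 / ?d" .
    moreover have "0 \<le> - 2 * ((w \<bullet> w)\<^sup>2 / ?d) + (w \<bullet> w)\<^sup>2 * \<phi> / ?d\<^sup>2"
      using \<phi>[of "- (w \<bullet> w) / ?d"] by (simp add: power_divide power2_eq_square)
    moreover have "(w \<bullet> w)\<^sup>2 / ?d > 0" using pos by (intro divide_pos_pos) auto
    ultimately show False by linarith
  qed
  then have "f v = c *\<^sub>R v" using fv by simp
  with v that show thesis by auto
qed

text \<open>Induction on the dimension: split off one unit eigenvector v. Self-adjointness keeps the
  orthogonal complement of v in S invariant, which is why the statement ranges over invariant
  subspaces and not only the whole space.\<close>

lemma orthonormal_eigenbasis: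
  fixes f :: "'a::euclidean_space \<Rightarrow> 'a"
  assumes f: "linear f" and self: "\<And>x y. x \<bullet> f y = f x \<bullet> y"
    and S: "subspace S" "f ` S \<subseteq> S"
  shows "\<exists>B. pairwise orthogonal B \<and> (\<forall>b\<in>B. norm b = 1) \<and> span B = S \<and> (\<forall>b\<in>B. \<exists>c. f b = c *\<^sub>R b)"
  using S
proof (induction "dim S" arbitrary: S rule: less_induct)
  case less
  show ?case
  proof (cases "S = {0}")
    case True
    then show ?thesis by (intro exI[of _ "{}"]) auto
  next
    case False
    then obtain v c where v: "v \<in> S" "norm v = 1" and fv: "f v = c *\<^sub>R v"
      using exists_eigenvector[OF f self less.prems] by metis
    define T where "T = {x \<in> S. v \<bullet> x = 0}"
    have "subspace T"
      using less.prems(1) unfolding T_def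
      by (auto simp: subspace_def inner_add_right)
    moreover have "f ` T \<subseteq> T"
      using less.prems(2) by (auto simp: T_def self fv)
    moreover have "v \<notin> T" "T \<subseteq> S" using v by (auto simp: T_def)
    then have "T \<subset> S" using v(1) by blast
    then have "dim T < dim S"
      using \<open>subspace T\<close> less.prems(1) by (intro dim_psubset) (simp add: span_eq_iff[THEN iffD2])
    ultimately obtain B where B: "pairwise orthogonal B" "\<forall>b\<in>B. norm b = 1" "span B = T"
      "\<forall>b\<in>B. \<exists>c. f b = c *\<^sub>R b"
      using less.hyps by blast
    have BT: "b \<in> T" if "b \<in> B" for b using B(3) span_superset that by blast
    have "span (insert v B) = S"
    proof
      show "span (insert v B) \<subseteq> S"
        using BT v less.prems(1) by (intro span_minimal) (auto simp: T_def)
      show "S \<subseteq> span (insert v B)"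
      proof
        fix x assume "x \<in> S"
        then have "x - (v \<bullet> x) *\<^sub>R v \<in> span B"
          unfolding B(3) T_def using v less.prems(1)
          by (auto simp: inner_diff_right dot_square_norm intro!: subspace_diff subspace_scale)
        then show "x \<in> span (insert v B)" unfolding span_insert by blast
      qed
    qed
    moreover have "pairwise orthogonal (insert v B)"
      using B(1) BT by (auto simp: pairwise_insert T_def orthogonal_def inner_commute)
    ultimately show ?thesis
      using B v fv by (intro exI[of _ "insert v B"]) auto
  qed
qed

lemma symmetric_matrix_diagonalization:
  fixes M :: "real^'n^'n"
  assumes "transpose M = M"
  obtains U :: "real^'n^'n" and d :: "'n \<Rightarrow> real"
  where "orthogonal_matrix U" "M ** U = U ** (\<chi> i j. if i = j then d i else 0)"
proof -
  have "x \<bullet> (M *v y) = (M *v x) \<bullet> y" for x y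
    by (metis assms dot_lmul_matrix transpose_matrix_vector)
  then obtain B where B: "pairwise orthogonal B" "\<forall>b\<in>B. norm b = 1" "span B = UNIV"
      "\<forall>b\<in>B. \<exists>c. M *v b = c *\<^sub>R b"
    using orthonormal_eigenbasis[of "(*v) M" UNIV] by auto
  \<comment> \<open>Orthonormal vectors are independent, so B has exactly \<open>CARD('n)\<close>
    elements. It can thus be indexed by \<open>'n\<close> and form the columns of a square
    matrix.\<close>
  have "independent B"
    using B(1,2) by (intro pairwise_orthogonal_independent) auto
  then have "card B = CARD('n)" "finite B"
    using B(3) dim_eq_card[of B UNIV] independent_imp_finite by (auto simp: dim_UNIV)
  then obtain h :: "'n \<Rightarrow> real^'n" where h: "bij_betw h UNIV B"
    using finite_same_card_bij[of "UNIV :: 'n set" B] by auto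
  then have hB: "h i \<in> B" for i by (auto simp: bij_betw_def)
  have "\<forall>i. \<exists>c. M *v h i = c *\<^sub>R h i" using B(4) hB by blast
  from choice[OF this] obtain d where d: "\<And>i. M *v h i = d i *\<^sub>R h i" by blast
  have hh: "h i \<bullet> h j = (if i = j then 1 else 0)" for i j
  proof (cases "i = j")
    case False
    then have "h i \<noteq> h j" using h by (auto simp: bij_betw_def inj_on_def)
    with B(1) hB False show ?thesis by (simp add: pairwise_def orthogonal_def)
  qed (use B(2) hB in \<open>simp add: dot_square_norm\<close>)
  define U :: "real^'n^'n" where "U = (\<chi> i j. h j $ i)"
  have "orthogonal_matrix U"
    using hh by (simp add: orthogonal_matrix vec_eq_iff matrix_matrix_mult_def transpose_def U_def
        mat_def inner_vec_def)
  moreover have "M ** U = U ** (\<chi> i j. if i = j then d i else 0)"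
    using d by (simp add: vec_eq_iff matrix_matrix_mult_def matrix_vector_mult_def U_def
        mult.commute if_distrib cong: if_cong)
  ultimately show thesis using that by blast
qed

section \<open>Invariance of the characteristic polynomial under similarity\<close>

definition const_mat :: "real^'n^'m \<Rightarrow> real poly^'n^'m"
  where "const_mat M = (\<chi> i j. [:M $ i $ j:])"

lemma const_mat_mult: "const_mat (A ** B) = const_mat A ** const_mat B"
proof -
  have "[:sum g S:] = (\<Sum>k\<in>S. [:g k:])" for g :: "'c \<Rightarrow> real" and S
    by (rule poly_eqI) (auto simp: coeff_sum coeff_pCons split: nat.split)
  then show ?thesis
    by (simp add: const_mat_def matrix_matrix_mult_def vec_eq_iff mult.commute)
qed

lemma const_mat_1: "const_mat (mat 1) = mat 1"
  by (auto simp: const_mat_def mat_def vec_eq_iff)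

lemma mat_mult_commute:
  fixes N :: "'a::comm_semiring_1^'n^'n"
  shows "mat c ** N = N ** mat c"
  by (simp add: vec_eq_iff matrix_matrix_mult_def mat_def if_distrib if_distribR mult.commute cong: if_cong)

lemma matrix_mult_diff_distrib:
  fixes A B C :: "'a::comm_ring_1^'n^'n"
  shows "(A - B) ** C = A ** C - B ** C" "C ** (A - B) = C ** A - C ** B"
  by (simp_all add: vec_eq_iff matrix_matrix_mult_def algebra_simps sum_subtractf)

text \<open>Over the polynomial ring, (X - M) U = U (X - D). Taking determinants, det U cancels: it
  is nonzero because its product with det V is 1.\<close>

lemma charpoly_similar:
  fixes M D U V :: "real^'n^'n"
  assumes "U ** V = mat 1" "M ** U = U ** D"
  shows "charpoly M = charpoly D"
proof -
  let ?X = "mat [:0, 1:] :: real poly^'n^'n"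
  have "(?X - const_mat M) ** const_mat U = const_mat U ** (?X - const_mat D)"
    by (simp add: matrix_mult_diff_distrib mat_mult_commute assms(2) flip: const_mat_mult)
  then have "charpoly M * det (const_mat U) = det (const_mat U) * charpoly D"
    unfolding charpoly_def const_mat_def[symmetric] by (metis det_mul)
  moreover have "det (const_mat U) * det (const_mat V) = 1"
    by (simp add: assms(1) const_mat_1 flip: det_mul const_mat_mult)
  then have "det (const_mat U) \<noteq> 0" by auto
  ultimately show ?thesis by (simp add: mult.commute)
qed

lemma eigenvalues_diagonal:
  "eigenvalues (\<chi> i j. if i = j then d i else 0 :: real^'n^'n) = image_mset d (mset_set UNIV)"
proof -
  have "charpoly (\<chi> i j. if i = j then d i else 0 :: real^'n^'n) = (\<Prod>i\<in>UNIV. [:- d i, 1:])"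
    unfolding charpoly_def by (subst det_diagonal) (auto simp: mat_def)
  moreover have "(\<Sum>i\<in>S. {#d i#}) = image_mset d (mset_set S)" if "finite S" for S :: "'n set"
    using that by (induction S rule: finite_induct) auto
  ultimately show ?thesis
    by (simp add: eigenvalues_def proots_prod)
qed

text \<open>Diagonalization turns both traces into power sums of the eigenvalues, and
  \<open>sum_pairs_list\<close> links these to \<open>sigma2\<close>. From here on the spectrum
  enters only through this formula.\<close>

lemma sigma2_eq_trace:
  fixes M :: "real^'n^'n"
  assumes "transpose M = M"
  shows "2 * sigma2 M = (trace M)\<^sup>2 - trace (M ** M)"
proof -
  obtain U d where U: "orthogonal_matrix U"
    and MU: "M ** U = U ** (\<chi> i j. if i = j then d i else 0)" (is "_ = _ ** ?D")
    using symmetric_matrix_diagonalization[OF assms] .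
  have UU: "U ** transpose U = mat 1" "transpose U ** U = mat 1"
    using U by (auto simp: orthogonal_matrix_def)
  have M: "M = U ** (?D ** transpose U)"
    using UU(1) by (simp add: matrix_mul_assoc flip: MU) (simp flip: matrix_mul_assoc)
  have tr: "trace (U ** (N ** transpose U)) = trace N" for N :: "real^'n^'n"
    by (subst trace_mul_sym) (simp add: UU(2) flip: matrix_mul_assoc)
  have MM: "M ** M = U ** ((?D ** ?D) ** transpose U)"
    by (subst (2) M) (simp add: matrix_mul_assoc MU)
  have trM: "trace M = (\<Sum>i\<in>UNIV. d i)"
    by (subst M, subst tr) (simp add: trace_def)
  have "trace (M ** M) = (\<Sum>i\<in>UNIV. (d i)\<^sup>2)"
  proof -
    have "(if i = k then d i else 0) * (if k = i then d k else 0) = (if k = i then (d i)\<^sup>2 else 0)" for i k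
      by (simp add: power2_eq_square)
    then show ?thesis
      unfolding MM tr by (simp add: trace_def matrix_matrix_mult_def)
  qed
  moreover
  let ?m = "image_mset d (mset_set UNIV)"
  have "eigenvalues M = ?m"
    using charpoly_similar[OF UU(1) MU] eigenvalues_diagonal[of d] by (simp add: eigenvalues_def)
  then have "2 * sigma2 M = (sum_list (sorted_list_of_multiset ?m))\<^sup>2 - (\<Sum>x\<leftarrow>sorted_list_of_multiset ?m. x\<^sup>2)"
    by (simp add: sigma2_def Let_def sum_pairs_list)
  moreover have "sum_list (sorted_list_of_multiset ?m) = (\<Sum>i\<in>UNIV. d i)"
    by (simp flip: sum_mset_sum_list sum_unfold_sum_mset)
  moreover have "(\<Sum>x\<leftarrow>sorted_list_of_multiset ?m. x\<^sup>2) = (\<Sum>i\<in>UNIV. (d i)\<^sup>2)"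
    by (subst sum_mset_sum_list[symmetric], subst mset_map)
      (simp add: image_mset.compositionality comp_def flip: sum_unfold_sum_mset)
  ultimately show ?thesis using trM by simp
qed

subsection \<open>A dual quadratic form\<close>

lemma mult_matrix_inv:
  fixes A :: "'a::semiring_1^'n^'n"
  assumes "invertible A"
  shows "A ** matrix_inv A = mat 1" "matrix_inv A ** A = mat 1"
proof -
  have "A ** matrix_inv A = mat 1 \<and> matrix_inv A ** A = mat 1"
    using assms unfolding invertible_def matrix_inv_def by (rule someI_ex)
  then show "A ** matrix_inv A = mat 1" "matrix_inv A ** A = mat 1" by auto
qed

lemma symmetric_matrix_inner:
  fixes M :: "real^'n^'n"
  assumes "transpose M = M"
  shows "x \<bullet> (M *v y) = (M *v x) \<bullet> y"
  by (metis assms dot_lmul_matrix transpose_matrix_vector)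

lemma sym_pos_def_add: "sym_pos_def A \<Longrightarrow> sym_pos_def B \<Longrightarrow> sym_pos_def (A + B)"
  by (auto simp: sym_pos_def_def transpose_def vec_eq_iff matrix_vector_mult_add_rdistrib
      inner_add_right add_pos_pos)

lemma sym_pos_def_nonneg: "sym_pos_def A \<Longrightarrow> 0 \<le> x \<bullet> (A *v x)"
  by (cases "x = 0") (auto simp: sym_pos_def_def less_imp_le)

lemma sym_pos_def_invertible:
  assumes "sym_pos_def A"
  shows "invertible A"
proof -
  have "x = 0" if "A *v x = 0" for x
    using assms that by (force simp: sym_pos_def_def)
  then show ?thesis
    using invertible_left_inverse matrix_left_invertible_ker by blast
qed

lemma sym_pos_def_inv:
  assumes A: "sym_pos_def A"
  shows "sym_pos_def (matrix_inv A)"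
proof -
  note inv = mult_matrix_inv[OF sym_pos_def_invertible[OF A]]
  have sym: "transpose A = A" using A by (simp add: sym_pos_def_def)
  have "transpose (matrix_inv A) ** A = mat 1"
    using inv(1) by (metis matrix_transpose_mul sym transpose_mat)
  then have "transpose (matrix_inv A) = matrix_inv A"
    by (metis inv(1) matrix_mul_assoc matrix_mul_lid matrix_mul_rid)
  moreover have "0 < x \<bullet> (matrix_inv A *v x)" if "x \<noteq> 0" for x
  proof -
    let ?y = "matrix_inv A *v x"
    have x: "x = A *v ?y" using inv by (simp add: matrix_vector_mul_assoc)
    with that have "?y \<noteq> 0" by (metis matrix_vector_mult_0_right)
    then have "0 < ?y \<bullet> (A *v ?y)" using A unfolding sym_pos_def_def by blast
    then show ?thesis using x by (simp add: inner_commute)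
  qed
  ultimately show ?thesis by (simp add: sym_pos_def_def)
qed

text \<open>Legendre duality: with y = A^-1 p, the difference of the two sides is (y - z) . A (y -
  z), which is nonnegative.\<close>

lemma inner_inv_ge:
  assumes A: "sym_pos_def A"
  shows "2 * (z \<bullet> p) - z \<bullet> (A *v z) \<le> p \<bullet> (matrix_inv A *v p)"
proof -
  let ?y = "matrix_inv A *v p"
  have sym: "transpose A = A" using A by (simp add: sym_pos_def_def)
  have p: "A *v ?y = p"
    using mult_matrix_inv[OF sym_pos_def_invertible[OF A]] by (simp add: matrix_vector_mul_assoc)
  have "?y \<bullet> (A *v z) = z \<bullet> p"
    using symmetric_matrix_inner[OF sym, of ?y z] p by (simp add: inner_commute)
  then show ?thesis
    using sym_pos_def_nonneg[OF A, of "?y - z"]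
    by (simp add: matrix_vector_mult_diff_distrib p inner_diff_left inner_diff_right inner_commute[of _ p])
qed

text \<open>Joint convexity of (A, p) \<mapsto> p . A^-1 p, stated as subadditivity because the map
  is homogeneous of degree one. The maximizer z for A + B is inserted into the dual lower bounds for
  A and for B, whose sum is then exactly the left-hand side.\<close>

lemma parallel_sum_le:
  assumes A: "sym_pos_def A" and B: "sym_pos_def B"
  shows "(p + q) \<bullet> (matrix_inv (A + B) *v (p + q)) \<le> p \<bullet> (matrix_inv A *v p) + q \<bullet> (matrix_inv B *v q)"
proof -
  define z where "z = matrix_inv (A + B) *v (p + q)"
  have "(A + B) *v z = p + q"
    using mult_matrix_inv[OF sym_pos_def_invertible[OF sym_pos_def_add[OF A B]]]
    by (simp add: z_def matrix_vector_mul_assoc)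
  then have "z \<bullet> (A *v z) + z \<bullet> (B *v z) = z \<bullet> p + z \<bullet> q"
    by (metis inner_add_right matrix_vector_mult_add_rdistrib)
  with inner_inv_ge[OF A, of z p] inner_inv_ge[OF B, of z q] show ?thesis
    unfolding z_def[symmetric] by (simp add: inner_commute inner_add_right)
qed

text \<open>This is Tr(V^T M V), the sum of the squared M-norms of the columns of V.\<close>

definition gram_trace :: "real^'n^'n \<Rightarrow> real^'k^'n \<Rightarrow> real"
  where "gram_trace M V = (\<Sum>l\<in>UNIV. (V *v axis l 1) \<bullet> (M *v (V *v axis l 1)))"

text \<open>A quadratic in d whose minimum, for positive \<open>gram_trace M V\<close>, is x . Mx -
  |V^T M x|^2 / \<open>gram_trace M V\<close>.\<close>

definition dual_form :: "real^'n^'n \<Rightarrow> real^'k^'n \<Rightarrow> real^'n \<Rightarrow> real^'k \<Rightarrow> real"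
  where "dual_form M V x d = x \<bullet> (M *v x) - 2 * (x \<bullet> (M *v (V *v d))) + gram_trace M V * (d \<bullet> d)"

text \<open>The second term is the norm of the wedge of \<open>d\<close> with the columns of \<open>V\<close>; it supplies exactly
  the part of \<open>gram_trace M V * (d \<bullet> d)\<close> that completing the square in the first term leaves over.\<close>
lemma dual_form_sum_of_squares:
  fixes V :: "real^'k^'n"
  assumes sym: "transpose M = M"
  shows "dual_form M V x d = (x - V *v d) \<bullet> (M *v (x - V *v d))
    + (\<Sum>k\<in>UNIV. \<Sum>l\<in>UNIV. (V *v (d $ k *\<^sub>R axis l 1 - d $ l *\<^sub>R axis k 1))
        \<bullet> (M *v (V *v (d $ k *\<^sub>R axis l 1 - d $ l *\<^sub>R axis k 1)))) / 2"
proof -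
  define e :: "'k \<Rightarrow> real^'n" where "e l = V *v axis l 1" for l
  define G where "G k l = e k \<bullet> (M *v e l)" for k l
  have Gsym: "G k l = G l k" for k l
    unfolding G_def by (simp add: symmetric_matrix_inner[OF sym, of "e k"] inner_commute)
  have Vd: "V *v d = (\<Sum>k\<in>UNIV. d $ k *\<^sub>R e k)"
    by (simp only: e_def matrix_mult_sum[of V d] matrix_vector_mult_basis scalar_mult_eq_scaleR)
  have VdVd: "(V *v d) \<bullet> (M *v (V *v d)) = (\<Sum>k\<in>UNIV. \<Sum>l\<in>UNIV. d $ k * d $ l * G l k)"
    unfolding Vd G_def
    by (simp add: linear_sum[OF matrix_vector_mul_linear] matrix_vector_mult_scaleR inner_sum_left
        inner_sum_right sum_distrib_left mult_ac)
  have "(V *v (d $ k *\<^sub>R axis l 1 - d $ l *\<^sub>R axis k 1))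
        \<bullet> (M *v (V *v (d $ k *\<^sub>R axis l 1 - d $ l *\<^sub>R axis k 1)))
      = (d $ k)\<^sup>2 * G l l - 2 * (d $ k * d $ l * G k l) + (d $ l)\<^sup>2 * G k k" for k l
    using Gsym[of k l] unfolding G_def e_def
    by (simp add: matrix_vector_mult_diff_distrib matrix_vector_mult_scaleR inner_diff_left inner_diff_right
        power2_eq_square algebra_simps)
  moreover have "gram_trace M V * (d \<bullet> d) = (\<Sum>k\<in>UNIV. \<Sum>l\<in>UNIV. (d $ l)\<^sup>2 * G k k)"
    unfolding gram_trace_def inner_vec_def[of d] sum_product
    by (simp add: G_def e_def power2_eq_square mult_ac)
  moreover from this have "gram_trace M V * (d \<bullet> d) = (\<Sum>k\<in>UNIV. \<Sum>l\<in>UNIV. (d $ k)\<^sup>2 * G l l)"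
    by (subst sum.swap)
  \<comment> \<open>This is Lagrange's identity for d and the columns of V, with lengths measured in
    the M-norm.\<close>
  ultimately have sum_eq: "(\<Sum>k\<in>UNIV. \<Sum>l\<in>UNIV. (V *v (d $ k *\<^sub>R axis l 1 - d $ l *\<^sub>R axis k 1))
        \<bullet> (M *v (V *v (d $ k *\<^sub>R axis l 1 - d $ l *\<^sub>R axis k 1))))
      = 2 * (gram_trace M V * (d \<bullet> d)) - 2 * ((V *v d) \<bullet> (M *v (V *v d)))"
    by (simp add: VdVd Gsym sum.distrib sum_subtractf sum_distrib_left)
  have "(V *v d) \<bullet> (M *v x) = x \<bullet> (M *v (V *v d))"
    by (simp add: symmetric_matrix_inner[OF sym, of x] inner_commute)
  then show ?thesis
    unfolding dual_form_def sum_eq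
    by (simp add: matrix_vector_mult_diff_distrib inner_diff_left inner_diff_right diff_divide_distrib)
qed

text \<open>In the sum-of-squares form every square is the M-norm squared of a vector affine in d,
  so at the combined point it is t p + (1 - t) q. Then \<open>parallel_sum_le\<close> applies to t p
  and (1 - t) q, and the scalings come out as t^2 and (1 - t)^2.\<close>

lemma dual_form_parallel_le:
  fixes A B :: "real^'n^'n"
  assumes A: "sym_pos_def A" and B: "sym_pos_def B"
  shows "dual_form (matrix_inv (A + B)) V x (t *\<^sub>R d + (1 - t) *\<^sub>R e)
    \<le> t\<^sup>2 * dual_form (matrix_inv A) V x d + (1 - t)\<^sup>2 * dual_form (matrix_inv B) V x e"
proof -
  have sym: "transpose (matrix_inv C) = matrix_inv C" if "sym_pos_def C" for C :: "real^'n^'n"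
    using sym_pos_def_inv[OF that] by (simp add: sym_pos_def_def)
  have quad: "r \<bullet> (matrix_inv (A + B) *v r)
      \<le> t\<^sup>2 * (p \<bullet> (matrix_inv A *v p)) + (1 - t)\<^sup>2 * (q \<bullet> (matrix_inv B *v q))"
    if "r = t *\<^sub>R p + (1 - t) *\<^sub>R q" for p q r
    using parallel_sum_le[OF A B, of "t *\<^sub>R p" "(1 - t) *\<^sub>R q"] that
    by (simp add: matrix_vector_mult_scaleR power2_eq_square mult.assoc)
  let ?c = "t *\<^sub>R d + (1 - t) *\<^sub>R e"
  let ?w = "\<lambda>c k l. V *v (c $ k *\<^sub>R axis l 1 - c $ l *\<^sub>R axis k 1)"
  let ?S = "\<lambda>C c. \<Sum>k\<in>UNIV. \<Sum>l\<in>UNIV. ?w c k l \<bullet> (matrix_inv C *v ?w c k l)"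
  have "?S (A + B) ?c \<le> (\<Sum>k\<in>UNIV. \<Sum>l\<in>UNIV. t\<^sup>2 * (?w d k l \<bullet> (matrix_inv A *v ?w d k l))
      + (1 - t)\<^sup>2 * (?w e k l \<bullet> (matrix_inv B *v ?w e k l)))"
    by (intro sum_mono quad)
      (simp add: matrix_vector_mult_diff_distrib matrix_vector_mult_scaleR algebra_simps)
  also have "\<dots> = t\<^sup>2 * ?S A d + (1 - t)\<^sup>2 * ?S B e"
    by (simp add: sum.distrib sum_distrib_left)
  finally have S: "?S (A + B) ?c \<le> t\<^sup>2 * ?S A d + (1 - t)\<^sup>2 * ?S B e" .
  have "(x - V *v ?c) \<bullet> (matrix_inv (A + B) *v (x - V *v ?c))
      \<le> t\<^sup>2 * ((x - V *v d) \<bullet> (matrix_inv A *v (x - V *v d)))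
        + (1 - t)\<^sup>2 * ((x - V *v e) \<bullet> (matrix_inv B *v (x - V *v e)))"
    by (intro quad) (simp add: matrix_vector_right_distrib matrix_vector_mult_scaleR algebra_simps)
  with S show ?thesis
    unfolding dual_form_sum_of_squares[OF sym[OF A]] dual_form_sum_of_squares[OF sym[OF B]]
      dual_form_sum_of_squares[OF sym[OF sym_pos_def_add[OF A B]]]
    by (simp add: algebra_simps)
qed

text \<open>The cross term is c . d, so completing the square in d puts the minimum at d = c /
  \<open>gram_trace M V\<close>.\<close>

lemma dual_form_min:
  fixes M :: "real^'n^'n" and V :: "real^'k^'n" and x :: "real^'n"
  assumes sym: "transpose M = M" and pos: "gram_trace M V > 0"
  defines "c \<equiv> transpose V *v (M *v x)"
  shows "dual_form M V x (c /\<^sub>R gram_trace M V) = x \<bullet> (M *v x) - (c \<bullet> c) / gram_trace M V"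
    and "x \<bullet> (M *v x) - (c \<bullet> c) / gram_trace M V \<le> dual_form M V x d"
proof -
  let ?\<tau> = "gram_trace M V"
  have c: "x \<bullet> (M *v (V *v d)) = c \<bullet> d" for d
    unfolding c_def symmetric_matrix_inner[OF sym, of x]
    by (metis dot_lmul_matrix transpose_matrix_vector)
  show "dual_form M V x (c /\<^sub>R ?\<tau>) = x \<bullet> (M *v x) - (c \<bullet> c) / ?\<tau>"
    using pos by (simp add: dual_form_def c field_simps)
  have "0 \<le> (?\<tau> *\<^sub>R d - c) \<bullet> (?\<tau> *\<^sub>R d - c) / ?\<tau>"
    using pos by (intro divide_nonneg_pos) auto
  also have "\<dots> = ?\<tau> * (d \<bullet> d) - 2 * (c \<bullet> d) + (c \<bullet> c) / ?\<tau>"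
    using pos by (simp add: inner_diff_left inner_diff_right inner_commute field_simps)
  finally show "x \<bullet> (M *v x) - (c \<bullet> c) / ?\<tau> \<le> dual_form M V x d"
    by (simp add: dual_form_def c)
qed

subsection \<open>The projection onto a hyperplane\<close>

lemma sym_pos_def_minor_pos:
  fixes M :: "real^'n^'n"
  assumes M: "sym_pos_def M" and ij: "i \<noteq> j"
  shows "0 < M $ i $ i * M $ j $ j - M $ i $ j * M $ j $ i"
proof -
  have sym: "M $ j $ i = M $ i $ j"
    using M unfolding sym_pos_def_def transpose_def by (metis vec_lambda_beta)
  have entry: "axis k 1 \<bullet> (M *v axis l 1) = M $ k $ l" for k l
    by (simp add: inner_axis' matrix_vector_mult_basis column_def)
  have "axis j (1::real) \<noteq> 0" by (simp add: axis_eq_0_iff)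
  then have jj: "0 < M $ j $ j"
    using M entry[of j j] unfolding sym_pos_def_def by metis
  \<comment> \<open>Up to the factor \<open>M $ j $ j\<close>, this is the i-th axis made
    M-orthogonal to the j-th, so its M-norm squared is a positive multiple of the minor.\<close>
  let ?x = "M $ j $ j *\<^sub>R axis i 1 - M $ i $ j *\<^sub>R axis j 1 :: real^'n"
  have "?x $ i \<noteq> 0" using jj ij by (simp add: axis_def)
  then have "?x \<noteq> 0" by (metis zero_index)
  then have "0 < ?x \<bullet> (M *v ?x)"
    using M unfolding sym_pos_def_def by blast
  also have "?x \<bullet> (M *v ?x) = M $ j $ j * (M $ i $ i * M $ j $ j - M $ i $ j * M $ j $ i)"
    by (simp add: matrix_vector_mult_diff_distrib matrix_vector_mult_scaleR inner_diff_left inner_diff_right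
        entry sym algebra_simps)
  finally show ?thesis using jj by (simp add: zero_less_mult_iff)
qed

text \<open>By the trace formula, 2 \<open>sigma2 M\<close> is the sum of the minors over all
  ordered pairs (k, l). Those with k = l vanish and the others are positive; the two distinct
  indices provide a positive one.\<close>

lemma sigma2_pos:
  fixes M :: "real^'n^'n"
  assumes M: "sym_pos_def M" and ij: "(i :: 'n) \<noteq> j"
  shows "0 < sigma2 M"
proof -
  let ?m = "\<lambda>i j. M $ i $ i * M $ j $ j - M $ i $ j * M $ j $ i"
  have nonneg: "0 \<le> ?m k l" for k l
    using sym_pos_def_minor_pos[OF M, of k l] by (cases "k = l") auto
  have "0 < (\<Sum>k\<in>UNIV. \<Sum>l\<in>UNIV. ?m k l)"
  proof (rule sum_pos2[of _ i])
    show "0 < (\<Sum>l\<in>UNIV. ?m i l)"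
      by (rule sum_pos2[of _ j]) (use sym_pos_def_minor_pos[OF M ij] nonneg in auto)
  qed (auto intro!: sum_nonneg nonneg)
  also have "\<dots> = (trace M)\<^sup>2 - trace (M ** M)"
    by (simp add: trace_def matrix_matrix_mult_def sum_subtractf power2_eq_square sum_product)
  also have "\<dots> = 2 * sigma2 M"
    using M by (simp add: sigma2_eq_trace sym_pos_def_def)
  finally show ?thesis by simp
qed

section \<open>The projection matrix P and its traces\<close>

definition hyperplane_proj :: "real^'n \<Rightarrow> real^'n^'n"
  where "hyperplane_proj \<alpha> = mat 1 - (columnvector \<alpha> :: real^1^'n) ** (rowvector \<alpha> :: real^'n^1)"

lemma hyperplane_proj_alt: "hyperplane_proj \<alpha> = mat 1 - (\<chi> i j. \<alpha> $ i * \<alpha> $ j)"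
  by (simp add: hyperplane_proj_def matrix_matrix_mult_def columnvector_def rowvector_def)

lemma hyperplane_proj_entry: "hyperplane_proj \<alpha> $ i $ j = (if i = j then 1 else 0) - \<alpha> $ i * \<alpha> $ j"
  by (simp add: hyperplane_proj_alt mat_def)

lemma hyperplane_proj_mult: "hyperplane_proj \<alpha> *v x = x - (\<alpha> \<bullet> x) *\<^sub>R \<alpha>"
proof -
  have "(\<chi> i j. \<alpha> $ i * \<alpha> $ j) *v x = (\<alpha> \<bullet> x) *\<^sub>R \<alpha>"
    by (simp add: vec_eq_iff matrix_vector_mult_def inner_vec_def sum_distrib_left mult_ac)
  then show ?thesis
    by (simp add: hyperplane_proj_alt matrix_vector_mult_diff_rdistrib)
qed

lemma transpose_hyperplane_proj: "transpose (hyperplane_proj \<alpha>) = hyperplane_proj \<alpha>"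
  by (auto simp: vec_eq_iff transpose_def hyperplane_proj_entry)

context
  fixes \<alpha> :: "real^'n"
  assumes unit: "norm \<alpha> = 1"
begin

lemma inner_unit: "\<alpha> \<bullet> \<alpha> = 1"
  using unit by (simp add: dot_square_norm)

lemma trace_hyperplane_proj:
  "trace (hyperplane_proj \<alpha> ** M) = trace M - \<alpha> \<bullet> (M *v \<alpha>)"
proof -
  have "trace ((\<chi> i j. \<alpha> $ i * \<alpha> $ j) ** M) = \<alpha> \<bullet> (M *v \<alpha>)"
    unfolding trace_def matrix_matrix_mult_def
    by (simp, subst sum.swap) (simp add: inner_vec_def matrix_vector_mult_def sum_distrib_left mult_ac)
  then show ?thesis
    by (simp add: hyperplane_proj_alt matrix_mult_diff_distrib trace_sub)
qed

text \<open>The left side is Tr(P M P), which equals Tr(P M) because P is idempotent for a unit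
  vector \<alpha>; the proof expands it axis by axis.\<close>

lemma gram_trace_hyperplane_proj:
  assumes sym: "transpose M = M"
  shows "gram_trace M (hyperplane_proj \<alpha>) = trace (hyperplane_proj \<alpha> ** M)"
proof -
  have 1: "(hyperplane_proj \<alpha> *v axis l 1) \<bullet> (M *v (hyperplane_proj \<alpha> *v axis l 1))
      = M $ l $ l - 2 * (\<alpha> $ l * (M *v \<alpha>) $ l) + (\<alpha> $ l)\<^sup>2 * (\<alpha> \<bullet> (M *v \<alpha>))" for l
  proof -
    have "axis l 1 \<bullet> (M *v axis l 1) = M $ l $ l"
      by (simp add: inner_axis' matrix_vector_mult_basis column_def)
    moreover have "\<alpha> \<bullet> (M *v axis l 1) = (M *v \<alpha>) $ l"
      by (simp add: symmetric_matrix_inner[OF sym] inner_axis)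
    ultimately show ?thesis
      by (simp add: hyperplane_proj_mult matrix_vector_mult_diff_distrib matrix_vector_mult_scaleR
          inner_diff_left inner_diff_right inner_axis inner_axis' power2_eq_square algebra_simps)
  qed
  have "(\<Sum>l\<in>UNIV. \<alpha> $ l * (M *v \<alpha>) $ l) = \<alpha> \<bullet> (M *v \<alpha>)" "(\<Sum>l\<in>UNIV. (\<alpha> $ l)\<^sup>2) = 1"
    using inner_unit by (simp_all add: inner_vec_def power2_eq_square)
  then show ?thesis
    by (simp add: gram_trace_def 1 trace_hyperplane_proj sum.distrib sum_subtractf trace_def[of M]
        flip: sum_distrib_left sum_distrib_right)
qed

text \<open>The trace is a sum of squared M-norms of the columns of P, so it suffices that P is
  nonzero. If P were zero, its diagonal would force \<alpha>_i and \<alpha>_j to be nonzero, while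
  its (i, j) entry would force their product to vanish.\<close>

lemma gram_trace_hyperplane_proj_pos:
  assumes M: "sym_pos_def M" and ij: "(i :: 'n) \<noteq> j"
  shows "0 < gram_trace M (hyperplane_proj \<alpha>)"
proof -
  have "\<exists>l. hyperplane_proj \<alpha> *v axis l 1 \<noteq> 0"
  proof (rule ccontr)
    assume "\<not> ?thesis"
    then have "hyperplane_proj \<alpha> $ k $ l = 0" for k l
      by (metis matrix_vector_mult_basis column_def vec_lambda_beta zero_index)
    from this[of i i] this[of j j] this[of i j] ij show False
      by (auto simp: hyperplane_proj_entry)
  qed
  then obtain l where l: "hyperplane_proj \<alpha> *v axis l 1 \<noteq> 0" ..
  show ?thesis
    unfolding gram_trace_def
    by (rule sum_pos2[of _ l]) (use l M in \<open>auto simp: sym_pos_def_nonneg\<close>, auto simp: sym_pos_def_def)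
qed

text \<open>Each of the test vectors, the axes and \<alpha>, gets its own dual variable, so the
  minimum of the sum is the sum of the minima.\<close>

definition total_dual_form :: "real^'n^'n \<Rightarrow> ('n \<Rightarrow> real^'n) \<Rightarrow> real^'n \<Rightarrow> real"
  where "total_dual_form M D d = (\<Sum>i\<in>UNIV. dual_form M (hyperplane_proj \<alpha>) (axis i 1) (D i))
    + dual_form M (hyperplane_proj \<alpha>) \<alpha> d"

text \<open>Writes s as an attained minimum: the lower bound will serve for A + B, the attainment
  for A and for B.\<close>

lemma total_dual_form_min:
  assumes M: "sym_pos_def M" and ij: "(i :: 'n) \<noteq> j"
  defines "s \<equiv> 2 * sigma2 M / trace (hyperplane_proj \<alpha> ** M)"
  shows "s \<le> total_dual_form M D d" and "\<exists>D d. total_dual_form M D d = s"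
proof -
  let ?P = "hyperplane_proj \<alpha>"
  let ?\<tau> = "trace (?P ** M)"
  have sym: "transpose M = M" using M by (simp add: sym_pos_def_def)
  note \<tau> = gram_trace_hyperplane_proj[OF sym]
  have pos: "0 < gram_trace M ?P"
    by (rule gram_trace_hyperplane_proj_pos[OF M ij])
  define c where "c x = transpose ?P *v (M *v x)" for x
  define g where "g x = x \<bullet> (M *v x) - (c x \<bullet> c x) / ?\<tau>" for x
  have cc: "c x \<bullet> c x = (M *v x) \<bullet> (M *v x) - (\<alpha> \<bullet> (M *v x))\<^sup>2" for x
    using inner_unit
    by (simp add: c_def transpose_hyperplane_proj hyperplane_proj_mult inner_diff_left inner_diff_right
        inner_commute power2_eq_square)
  have 1: "(\<Sum>i\<in>UNIV. axis i 1 \<bullet> (M *v axis i 1)) = trace M"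
    by (simp add: trace_def inner_axis' matrix_vector_mult_basis column_def)
  have 2: "(\<Sum>i\<in>UNIV. (M *v axis i 1) \<bullet> (M *v axis i 1)) = trace (M ** M)"
    by (simp add: matrix_vector_mul_assoc flip: symmetric_matrix_inner[OF sym])
      (simp add: trace_def inner_axis' matrix_vector_mult_basis column_def)
  have 3: "(\<Sum>i\<in>UNIV. (\<alpha> \<bullet> (M *v axis i 1))\<^sup>2) = (M *v \<alpha>) \<bullet> (M *v \<alpha>)"
  proof -
    have "\<alpha> \<bullet> (M *v axis i 1) = (M *v \<alpha>) $ i" for i
      by (simp add: symmetric_matrix_inner[OF sym] inner_axis)
    then show ?thesis by (simp add: inner_vec_def power2_eq_square)
  qed
  \<comment> \<open>The axes contribute |M \<alpha>|^2 / \<tau> and the extra test vector \<alpha>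
    cancels it. With a = \<alpha> . M \<alpha> and \<tau> = Tr M - a, the identity (Tr M + a) (Tr M
    - a) + a^2 = (Tr M)^2 then yields s.\<close>
  have "(\<Sum>i\<in>UNIV. g (axis i 1)) + g \<alpha>
      = trace M + \<alpha> \<bullet> (M *v \<alpha>) - (trace (M ** M) - (\<alpha> \<bullet> (M *v \<alpha>))\<^sup>2) / ?\<tau>"
    by (simp add: g_def cc sum_subtractf 1 2 3 diff_divide_distrib flip: sum_divide_distrib)
  also have "\<dots> = s"
    using pos unfolding \<tau> s_def sigma2_eq_trace[OF sym]
    by (simp add: field_simps) (simp add: trace_hyperplane_proj power2_eq_square algebra_simps)
  finally have s: "(\<Sum>i\<in>UNIV. g (axis i 1)) + g \<alpha> = s" .
  show "s \<le> total_dual_form M D d"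
    unfolding s[symmetric] total_dual_form_def g_def c_def \<tau>[symmetric]
    by (intro add_mono sum_mono dual_form_min(2) sym pos)
  have "total_dual_form M (\<lambda>i. c (axis i 1) /\<^sub>R ?\<tau>) (c \<alpha> /\<^sub>R ?\<tau>) = s"
    unfolding s[symmetric] total_dual_form_def g_def c_def \<tau>[symmetric] dual_form_min(1)[OF sym pos] ..
  then show "\<exists>D d. total_dual_form M D d = s" by blast
qed

lemma total_dual_form_parallel_le:
  assumes "sym_pos_def A" "sym_pos_def B"
  shows "total_dual_form (matrix_inv (A + B)) (\<lambda>i. t *\<^sub>R D i + (1 - t) *\<^sub>R E i) (t *\<^sub>R d + (1 - t) *\<^sub>R e)
    \<le> t\<^sup>2 * total_dual_form (matrix_inv A) D d + (1 - t)\<^sup>2 * total_dual_form (matrix_inv B) E e"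
proof -
  have "(\<Sum>i\<in>UNIV. dual_form (matrix_inv (A + B)) (hyperplane_proj \<alpha>) (axis i 1) (t *\<^sub>R D i + (1 - t) *\<^sub>R E i))
    \<le> (\<Sum>i\<in>UNIV. t\<^sup>2 * dual_form (matrix_inv A) (hyperplane_proj \<alpha>) (axis i 1) (D i)
      + (1 - t)\<^sup>2 * dual_form (matrix_inv B) (hyperplane_proj \<alpha>) (axis i 1) (E i))"
    by (intro sum_mono dual_form_parallel_le assms)
  with dual_form_parallel_le[OF assms, of "hyperplane_proj \<alpha>" \<alpha> t d e] show ?thesis
    by (simp add: total_dual_form_def sum.distrib ring_distribs flip: sum_distrib_left)
qed

end

text \<open>The right side of the hypothesis is minimal at t = b / (a + b), where its value is a b /
  (a + b), the inverse of the sum of the inverses.\<close>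

lemma inverse_superadditive:
  fixes a b c :: real
  assumes "0 < a" "0 < b" "0 < c" and le: "\<And>t. c \<le> t\<^sup>2 * a + (1 - t)\<^sup>2 * b"
  shows "inverse a + inverse b \<le> inverse c"
proof -
  have "1 - b / (a + b) = a / (a + b)" using assms by (simp add: field_simps)
  then have "c \<le> (b / (a + b))\<^sup>2 * a + (a / (a + b))\<^sup>2 * b"
    using le[of "b / (a + b)"] by simp
  also have "\<dots> = (a * b * (a + b)) / (a + b)\<^sup>2"
    by (simp add: power_divide power2_eq_square algebra_simps add_divide_distrib)
  also have "\<dots> = (a * b) / (a + b)" by (simp add: power2_eq_square)
  also have "\<dots> = inverse (inverse a + inverse b)" using assms by (simp add: field_simps)
  finally have "inverse (inverse (inverse a + inverse b)) \<le> inverse c"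
    using assms by (intro le_imp_inverse_le) auto
  then show ?thesis by simp
qed

theorem proposition2p5:
  fixes A B P :: "real^'n^'n" and \<alpha> :: "real^'n"
  assumes "CARD('n) \<ge> 2"
    and "sym_pos_def A" and "sym_pos_def B"
    and "norm \<alpha> = 1"
    and "P = mat 1 - (columnvector \<alpha> :: real^1^'n) ** (rowvector \<alpha> :: real^'n^1)"
  shows "trace (P ** matrix_inv (A + B)) / sigma2 (matrix_inv (A + B))
       \<ge> trace (P ** matrix_inv A) / sigma2 (matrix_inv A)
         + trace (P ** matrix_inv B) / sigma2 (matrix_inv B)"
proof -
  have "\<not> CARD('n) \<le> Suc 0" using assms(1) by simp
  then obtain i j :: 'n where ij: "i \<noteq> j"
    by (auto simp: card_le_Suc0_iff_eq)
  have P: "P = hyperplane_proj \<alpha>" by (simp add: assms(5) hyperplane_proj_def)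
  define s where "s C = 2 * sigma2 (matrix_inv C) / trace (P ** matrix_inv C)" for C
  have s_pos: "0 < s C" if C: "sym_pos_def C" for C
  proof -
    note inv = sym_pos_def_inv[OF C]
    have "0 < trace (P ** matrix_inv C)"
      using gram_trace_hyperplane_proj_pos[OF assms(4) inv ij] inv
      by (simp add: P gram_trace_hyperplane_proj[OF assms(4)] sym_pos_def_def)
    then show ?thesis using sigma2_pos[OF inv ij] by (simp add: s_def)
  qed
  note min = total_dual_form_min[OF assms(4) sym_pos_def_inv ij, folded P, folded s_def]
  have AB: "sym_pos_def (A + B)" by (rule sym_pos_def_add[OF assms(2,3)])
  obtain D d where D: "total_dual_form \<alpha> (matrix_inv A) D d = s A" using min(2)[OF assms(2)] by blast
  obtain E e where E: "total_dual_form \<alpha> (matrix_inv B) E e = s B" using min(2)[OF assms(3)] by blast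
  \<comment> \<open>The minimizers for A and B are combined with weights t and 1 - t. The value for
    A + B at that point lies above the minimum \<open>s (A + B)\<close>.\<close>
  have "s (A + B) \<le> t\<^sup>2 * s A + (1 - t)\<^sup>2 * s B" for t
    using order_trans[OF min(1)[OF AB] total_dual_form_parallel_le[OF assms(4) assms(2,3)]] D E by metis
  then have "inverse (s A) + inverse (s B) \<le> inverse (s (A + B))"
    by (intro inverse_superadditive s_pos assms(2,3) AB)
  \<comment> \<open>Each ratio in the claim is twice the corresponding
    \<open>inverse (s C)\<close>.\<close>
  then show ?thesis by (simp add: s_def field_simps)
qed

end
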